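(* Consider the quantized self-triggered multi-agent system described in the context. Let upper bounds $\tau^i_{\max}>0$ be given, and assume: (a) $\delta_i+\dfrac{d_i}{R}<\dfrac{\gamma}{2\Gamma_\infty}$ for all $i\in\mathcal{N}$; (b) $0<\tau^i_{\min}\le\min\{\tilde\tau^i_{\min},\tau^i_{\max}\}$ for all $i\in\mathcal{N}$; (c) $0<\omega\le\tilde\omega$. Then the unsaturation condition $|x_i(t_k^i)-x_j(t_k^i)|\le E(t_k^i)$ holds for all $j\in\mathcal{N}_i$, $k\in\mathbb{N}_0$, $i\in\mathcal{N}$ (so all quantizer arguments lie in the quantization region), and \[ |x_i(t)-x_j(t)|\le 2\Gamma_\infty E_0e^{-\omega t}\qquad\text{for all } t\ge0,\ i,j\in\mathcal{N}; \] that is, the system achieves consensus exponentially with decay rate $\omega$ (with constant $2\Gamma_\infty$ independent of $E_0$).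
   Context: Setting. $N\ge2$ agents indexed by $\mathcal{N}=\{1,\dots,N\}$ communicate over a connected undirected graph $G$; $\mathcal{N}_i$ is the set of neighbors of agent $i$, $d_i=|\mathcal{N}_i|$, and $L$ is the graph Laplacian. $\mathbf{1}=(1,\dots,1)^\top$, $\bar{\mathbf{1}}=\frac1N\mathbf{1}^\top$, $\|\cdot\|_\infty$ is the maximum norm (and induced matrix norm), $\lambda_2(L)$ the second smallest eigenvalue of $L$, and $W$ the Lambert $W$-function on $[0,\infty)$ ($W(y)$ is the solution $x\ge0$ of $xe^x=y$). $\inf\emptyset=\infty$. Dynamics: $\dot x_i(t)=u_i(t)$, $x_i(0)=x_{i0}\in\mathbb{R}$. A constant $E_0>0$ satisfies $|x_{i0}-\frac1N\sum_{j}x_{j0}|\le E_0$ for all $i$. The number of quantization levels is $R=2R_0+1$ with $R_0\in\mathbb{N}_0$. Fix $0<\gamma\le\lambda_2(L)$ and $\Gamma_\infty:=\sup_{t\ge0}\|e^{\gamma t}(e^{-Lt}-\mathbf{1}\bar{\mathbf{1}})\|_\infty$ (finite). For $\omega>0$ define the quantization range $E(t):=2\Gamma_\infty E_0e^{-\omega t}$. Quantizer: for $E>0$ and $z\in[-E,E]$, $Q_{E,R}[z]=2pE/R$ if $(2p-1)E/R<z\le(2p+1)E/R$ with $p\in\{1,\dots,R_0\}$, $Q_{E,R}[z]=0$ if $|z|\le E/R$, and $Q_{E,R}[z]=-Q_{E,R}[-z]$ if $z<-E/R$. Sampling and control: each agent $i$ has parameters $\delta_i>0$, $0<\tau^i_{\min}\le\tau^i_{\max}$,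 and sampling times $t_0^i=0<t_1^i<\dots$. For $t_k^i\le t<t_{k+1}^i$, $u_i(t)=-q_i(t_k^i)$, where $q_i(t_k^i)=\sum_{j\in\mathcal{N}_i}Q_{E(t_k^i),R}[x_i(t_k^i)-x_j(t_k^i)]$. The next sampling time is $t_{k+1}^i=t_k^i+\min\{\tau_k^i,\tau^i_{\max}\}$ with \[ \tau_k^i=\inf\{\tau\ge\tau^i_{\min}: |f_k^i(\tau)|\ge\delta_iE(t_k^i+\tau)\},\qquad f_k^i(\tau)=\sum_{j\in\mathcal{N}_i}\int_{t_k^i}^{t_k^i+\tau}(u_i(s)-u_j(s))\,ds. \] Auxiliary constants: \[ \tilde\tau^i_{\min}:=\frac1\omega W\!\left(\frac{\omega\delta_i}{d_i^2+\sum_{j\in\mathcal{N}_i}d_je^{\omega\tau^j_{\max}}}\right),\qquad \tilde\omega:=\min_{i\in\mathcal{N}}\left(\eta_i-\frac{W(\xi_i\tau^i_{\max}e^{\eta_i\tau^i_{\max}})}{\tau^i_{\max}}\right), \] with $\xi_i:=2\Gamma_\infty d_i/R$ and $\eta_i:=\gamma-2\Gamma_\infty\delta_i$. *)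

theory Defs
  imports "HOL-Analysis.Analysis" "HOL-Computational_Algebra.Polynomial"
begin

section \<open>Graphs on the agent index type\<close>

(* undirected graph: symmetric, irreflexive adjacency relation *)
definition undirected_graph :: "('n \<Rightarrow> 'n \<Rightarrow> bool) \<Rightarrow> bool" where
  "undirected_graph adj \<longleftrightarrow> (\<forall>i j. adj i j = adj j i) \<and> (\<forall>i. \<not> adj i i)"

definition connected_graph :: "('n \<Rightarrow> 'n \<Rightarrow> bool) \<Rightarrow> bool" where
  "connected_graph adj \<longleftrightarrow> (\<forall>i j. (i, j) \<in> {(a, b). adj a b}\<^sup>*)"

definition nbrs :: "('n \<Rightarrow> 'n \<Rightarrow> bool) \<Rightarrow> 'n \<Rightarrow> 'n set" where
  "nbrs adj i = {j. adj i j}"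

definition degree :: "('n::finite \<Rightarrow> 'n \<Rightarrow> bool) \<Rightarrow> 'n \<Rightarrow> nat" where
  "degree adj i = card (nbrs adj i)"

definition laplacian :: "('n::finite \<Rightarrow> 'n \<Rightarrow> bool) \<Rightarrow> real^'n^'n" where
  "laplacian adj = (\<chi> i j. if i = j then real (degree adj i) else if adj i j then -1 else 0)"

section \<open>Matrix analysis\<close>

fun mpow :: "real^'n^'n \<Rightarrow> nat \<Rightarrow> real^'n^'n" where
  "mpow A 0 = mat 1"
| "mpow A (Suc k) = A ** mpow A k"

(* matrix exponential, defined by its power series entrywise *)
definition mexp :: "real^'n^'n \<Rightarrow> real^'n^'n" where
  "mexp A = (\<chi> i j. (\<Sum>k. (mpow A k $ i $ j) / fact k))"

(* matrix norm induced by the maximum norm (infnorm) *)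
definition mnorm_inf :: "real^'n^'n \<Rightarrow> real" where
  "mnorm_inf A = Sup {infnorm (A *v x) | x. infnorm x \<le> 1}"

(* the averaging matrix 1 * (1/N) 1^T *)
definition avg_mat :: "real^'n::finite^'n" where
  "avg_mat = (\<chi> i j. 1 / real CARD('n))"

(* characteristic polynomial det(X I - A) *)
definition charpoly :: "real^'n::finite^'n \<Rightarrow> real poly" where
  "charpoly A = det (\<chi> i j. (if i = j then [:0, 1:] else 0) - [:A $ i $ j:])"

(* second smallest eigenvalue, eigenvalues counted with algebraic multiplicity *)
definition lambda2 :: "real^'n::finite^'n \<Rightarrow> real" where
  "lambda2 A = (LEAST \<mu>::real. 2 \<le> (\<Sum>r \<in> {r. poly (charpoly A) r = 0 \<and> r \<le> \<mu>}. order r (charpoly A)))"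

definition Gamma_inf :: "real \<Rightarrow> real^'n::finite^'n \<Rightarrow> real" where
  "Gamma_inf \<gamma> L = (SUP t \<in> {0..}. mnorm_inf (exp (\<gamma> * t) *\<^sub>R (mexp (- (t *\<^sub>R L)) - avg_mat)))"

section \<open>Lambert W on [0,\<infinity>)\<close>

definition lambertW :: "real \<Rightarrow> real" where
  "lambertW y = (THE x. x \<ge> 0 \<and> x * exp x = y)"

section \<open>Quantizer with R = 2 R0 + 1 levels\<close>

definition quant_pos :: "real \<Rightarrow> nat \<Rightarrow> real \<Rightarrow> real" where
  "quant_pos E R0 z = (let R = real (2 * R0 + 1) in
     2 * real (THE p. p \<in> {1..R0} \<and> (2 * real p - 1) * E / R < z \<and> z \<le> (2 * real p + 1) * E / R) * E / R)"

definition quant :: "real \<Rightarrow> nat \<Rightarrow> real \<Rightarrow> real" where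
  "quant E R0 z = (let R = real (2 * R0 + 1) in
     if \<bar>z\<bar> \<le> E / R then 0
     else if z > E / R then quant_pos E R0 z
     else - quant_pos E R0 (- z))"

end

theory Submission
  imports Defs
begin

text \<open>
  Write the closed loop as \<open>x' = - L x + g\<close>, where \<open>g\<^sub>i\<close> collects the trigger function \<open>f\<close> and the
  quantization error. While the quantizers are unsaturated, the triggering rule (together with the
  choice of \<open>\<tau>min\<close> before the earliest triggering time) and \<open>E(t\<^sub>k) \<le> exp (\<omega> \<tau>max) E(t)\<close> give
  \<open>\<bar>g\<^sub>i(t)\<bar> \<le> (\<delta>\<^sub>i + d\<^sub>i exp (\<omega> \<tau>max) / R) E(t)\<close>, and \<open>\<omega> \<le> \<omega>t\<close> says precisely that this is at most
  \<open>(\<gamma> - \<omega>) E0 exp (- \<omega> t)\<close>. Variation of constants then bounds the distance to the average at \<open>t\<close> by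
  \<open>\<Gamma> E0 exp (- \<gamma> t) (1 + \<integral>\<^sub>0\<^sup>t (\<gamma> - \<omega>) exp ((\<gamma> - \<omega>) s) ds) = \<Gamma> E0 exp (- \<omega> t)\<close>. This uses unsaturation
  only at sampling times before \<open>t\<close>, so a first saturated sampling time cannot exist.

  The supremum defining \<open>\<Gamma>\<close> is meaningful only if it is finite. This follows from the energy
  estimate on the orthogonal complement of the constants, where the minimum of the Rayleigh quotient
  of \<open>L\<close> is a positive eigenvalue, hence at least \<open>\<lambda>\<^sub>2(L)\<close>.
\<close>

section \<open>The Lambert function\<close>

lemma mult_exp_mono:
  fixes x y :: real
  assumes "0 \<le> x" "x \<le> y"
  shows "x * exp x \<le> y * exp y"
  using assms by (intro mult_mono) auto

lemma mult_exp_strict_mono: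
  fixes x y :: real
  assumes "0 \<le> x" "x < y"
  shows "x * exp x < y * exp y"
  using assms by (intro mult_strict_mono') auto

text \<open>The intermediate value theorem on [0, y], using y \<le> y exp y, gives a solution, and
  strict monotonicity makes it the only one. So the description \<open>THE\<close> denotes, and
  inequalities about \<open>lambertW\<close> can be turned into inequalities about x exp x.\<close>

lemma lambertW_spec:
  assumes "0 \<le> y"
  shows "0 \<le> lambertW y" and "lambertW y * exp (lambertW y) = y"
proof -
  have "\<exists>x\<ge>0. x \<le> y \<and> x * exp x = y"
  proof (rule IVT')
    show "y \<le> y * exp y"
      using assms mult_left_mono[of 1 "exp y" y] by simp
  qed (use assms in \<open>auto intro!: continuous_intros\<close>)
  then have "\<exists>!x. x \<ge> 0 \<and> x * exp x = y"
    by (metis mult_exp_strict_mono less_irrefl linorder_neqE_linordered_idom)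
  from theI'[OF this] show "0 \<le> lambertW y" and "lambertW y * exp (lambertW y) = y"
    unfolding lambertW_def by auto
qed

lemma mult_exp_le_if_le_lambertW:
  assumes "0 \<le> y" "0 \<le> x" "x \<le> lambertW y"
  shows "x * exp x \<le> y"
  using mult_exp_mono[OF assms(2,3)] lambertW_spec[OF assms(1)] by simp

lemma le_mult_exp_if_lambertW_le:
  assumes "0 \<le> y" "lambertW y \<le> x"
  shows "y \<le> x * exp x"
  using mult_exp_mono[OF _ assms(2)] lambertW_spec[OF assms(1)] by simp

section \<open>The quantizer\<close>

text \<open>The bins of width 2E/R with p = 1..R0 tile the interval (E/R, E], so exactly one p is
  selected; its output is the midpoint of the bin, hence the error of half a width.\<close>

lemma quant_pos_bounds:
  assumes "E > 0" "E / real (2 * R0 + 1) < z" "z \<le> E"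
  shows "\<bar>quant_pos E R0 z - z\<bar> \<le> E / real (2 * R0 + 1)"
    and "0 \<le> quant_pos E R0 z" and "quant_pos E R0 z \<le> E"
proof -
  define R where "R = real (2 * R0 + 1)"
  have R: "R > 0" by (simp add: R_def)
  define P where "P p \<longleftrightarrow> p \<in> {1..R0} \<and> (2 * real p - 1) * E / R < z \<and> z \<le> (2 * real p + 1) * E / R"
    for p :: nat
  define c where "c = z * R / E"
  have P_iff: "P p \<longleftrightarrow> p \<in> {1..R0} \<and> 2 * real p - 1 < c \<and> c \<le> 2 * real p + 1" for p
    using assms(1) R by (simp add: P_def c_def field_simps)
  have c: "1 < c" "c \<le> R"
    using assms R unfolding c_def R_def[symmetric] by (simp_all add: field_simps)
  \<comment> \<open>After rescaling to c = zR/E, the bin condition reads 2p - 1 < c \<le> 2p + 1,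
    whose only integer solution is this ceiling.\<close>
  define p where "p = nat \<lceil>(c - 1) / 2\<rceil>"
  have p: "real p = of_int \<lceil>(c - 1) / 2\<rceil>"
    using c by (simp add: p_def)
  have ge: "c - 1 \<le> 2 * real p" and lt: "2 * real p < c + 1"
    unfolding p using ceiling_correct[of "(c - 1) / 2"] by argo+
  have "0 < real p" "real p < real R0 + 1"
    using ge lt c by (auto simp: R_def field_simps)
  then have "p \<in> {1..R0}" by auto
  then have "P p" using ge lt by (simp add: P_iff field_simps)
  moreover have "p' = p" if "P p'" for p'
  proof -
    have "real p' < real p + 1" "real p < real p' + 1"
      using that ge lt by (auto simp: P_iff)
    then show ?thesis by linarith
  qed
  ultimately have "(THE p. P p) = p" by blast
  then have q: "quant_pos E R0 z = 2 * real p * E / R"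
    unfolding quant_pos_def P_def R_def by simp
  have "(2 * real p - 1) * E / R < z" "z \<le> (2 * real p + 1) * E / R"
    using \<open>P p\<close> by (auto simp: P_def)
  then show "\<bar>quant_pos E R0 z - z\<bar> \<le> E / real (2 * R0 + 1)"
    unfolding q R_def[symmetric] using R by (simp add: abs_le_iff field_simps)
  show "0 \<le> quant_pos E R0 z"
    unfolding q using R assms by simp
  have "2 * real p \<le> R" using \<open>p \<in> {1..R0}\<close> by (simp add: R_def)
  then have "2 * real p * E \<le> R * E" using assms by (intro mult_right_mono) auto
  then show "quant_pos E R0 z \<le> E"
    unfolding q using R by (simp add: field_simps)
qed

lemma quant_error:
  assumes "E > 0" "\<bar>z\<bar> \<le> E"
  shows "\<bar>quant E R0 z - z\<bar> \<le> E / real (2 * R0 + 1)"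
  using quant_pos_bounds(1)[of E R0 z] quant_pos_bounds(1)[of E R0 "- z"] assms
  unfolding quant_def Let_def by (auto simp: abs_le_iff)

lemma abs_quant_le:
  assumes "E > 0" "\<bar>z\<bar> \<le> E"
  shows "\<bar>quant E R0 z\<bar> \<le> E"
  using quant_pos_bounds(2,3)[of E R0 z] quant_pos_bounds(2,3)[of E R0 "- z"] assms
  unfolding quant_def Let_def by (auto simp: abs_le_iff)

section \<open>The matrix exponential\<close>

lemma mpow_scaleR: "mpow (s *\<^sub>R A) k = s ^ k *\<^sub>R mpow A k"
  by (induction k)
    (simp_all add: vec_eq_iff matrix_matrix_mult_def sum_distrib_left algebra_simps)

lemma mpow_commute: "A ** mpow A k = mpow A k ** A"
proof (induction k)
  case (Suc k)
  then show ?case by (metis mpow.simps(2) matrix_mul_assoc)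
qed simp

text \<open>The sum K of all absolute entries dominates every row sum, so each multiplication by A
  costs at most a factor K. The bound is crude but suffices to compare with the exponential series
  of K.\<close>

lemma abs_mpow_le:
  fixes A :: "real^'n^'n"
  shows "\<bar>mpow A k $ i $ j\<bar> \<le> (\<Sum>a\<in>UNIV. \<Sum>b\<in>UNIV. \<bar>A $ a $ b\<bar>) ^ k" (is "_ \<le> ?K ^ k")
proof (induction k arbitrary: i)
  case 0
  then show ?case by (simp add: mat_def)
next
  case (Suc k)
  have "?K \<ge> 0" by (intro sum_nonneg) auto
  have "\<bar>mpow A (Suc k) $ i $ j\<bar> \<le> (\<Sum>l\<in>UNIV. \<bar>A $ i $ l\<bar> * \<bar>mpow A k $ l $ j\<bar>)"
    by (simp add: matrix_matrix_mult_def) (metis (no_types, lifting) abs_mult sum.cong sum_abs)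
  also have "\<dots> \<le> (\<Sum>l\<in>UNIV. \<bar>A $ i $ l\<bar> * ?K ^ k)"
    by (intro sum_mono mult_left_mono Suc) auto
  also have "\<dots> = (\<Sum>l\<in>UNIV. \<bar>A $ i $ l\<bar>) * ?K ^ k"
    by (simp add: sum_distrib_right)
  also have "\<dots> \<le> ?K * ?K ^ k"
    using \<open>?K \<ge> 0\<close>
    by (intro mult_right_mono member_le_sum[of i UNIV "\<lambda>a. \<Sum>b\<in>UNIV. \<bar>A $ a $ b\<bar>"] sum_nonneg) auto
  finally show ?case by simp
qed

lemma summable_mexp:
  fixes A :: "real^'n^'n"
  shows "summable (\<lambda>k. mpow A k $ i $ j / fact k * s ^ k)"
proof (rule summable_comparison_test')
  let ?K = "\<Sum>a\<in>UNIV. \<Sum>b\<in>UNIV. \<bar>A $ a $ b\<bar>"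
  show "summable (\<lambda>k. (?K * \<bar>s\<bar>) ^ k /\<^sub>R fact k)"
    using sums_summable[OF exp_converges] .
  show "norm (mpow A k $ i $ j / fact k * s ^ k) \<le> (?K * \<bar>s\<bar>) ^ k /\<^sub>R fact k" for k
    using mult_right_mono[OF abs_mpow_le[of A k i j], of "\<bar>s\<bar> ^ k / fact k"]
    by (simp add: abs_mult power_abs power_mult_distrib field_simps)
qed

text \<open>Along the ray s A every entry is an ordinary power series in s, which opens the way to
  termwise differentiation.\<close>

lemma mexp_scaleR_nth:
  fixes A :: "real^'n^'n"
  shows "mexp (s *\<^sub>R A) $ i $ j = (\<Sum>k. mpow A k $ i $ j / fact k * s ^ k)"
  by (simp add: mexp_def mpow_scaleR mult.commute)

lemma mult_mexp_nth:
  fixes A :: "real^'n^'n"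
  shows "(A ** mexp (s *\<^sub>R A)) $ i $ j = (\<Sum>k. mpow A (Suc k) $ i $ j / fact k * s ^ k)"
proof -
  have "(A ** mexp (s *\<^sub>R A)) $ i $ j
      = (\<Sum>l\<in>UNIV. \<Sum>k. A $ i $ l * (mpow A k $ l $ j / fact k * s ^ k))"
    by (simp only: matrix_matrix_mult_def vec_lambda_beta mexp_scaleR_nth suminf_mult[OF summable_mexp])
  also have "\<dots> = (\<Sum>k. \<Sum>l\<in>UNIV. A $ i $ l * (mpow A k $ l $ j / fact k * s ^ k))"
    by (intro suminf_sum[symmetric] summable_mult summable_mexp)
  finally show ?thesis
    by (simp add: matrix_matrix_mult_def sum_divide_distrib sum_distrib_left
        mult.commute mult.left_commute)
qed

lemma mexp_commute:
  fixes A :: "real^'n^'n"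
  shows "A ** mexp (s *\<^sub>R A) = mexp (s *\<^sub>R A) ** A"
proof -
  have "(mexp (s *\<^sub>R A) ** A) $ i $ j = (\<Sum>k. mpow A (Suc k) $ i $ j / fact k * s ^ k)" for i j
  proof -
    have "(mexp (s *\<^sub>R A) ** A) $ i $ j
        = (\<Sum>l\<in>UNIV. \<Sum>k. (mpow A k $ i $ l / fact k * s ^ k) * A $ l $ j)"
      by (simp only: matrix_matrix_mult_def vec_lambda_beta mexp_scaleR_nth suminf_mult2[OF summable_mexp])
    also have "\<dots> = (\<Sum>k. \<Sum>l\<in>UNIV. (mpow A k $ i $ l / fact k * s ^ k) * A $ l $ j)"
      by (intro suminf_sum[symmetric] summable_mult2 summable_mexp)
    finally show ?thesis
      unfolding mpow.simps mpow_commute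
      by (simp add: matrix_matrix_mult_def sum_divide_distrib sum_distrib_left
        mult.commute mult.left_commute)
  qed
  then show ?thesis by (simp add: vec_eq_iff mult_mexp_nth)
qed

lemma DERIV_mexp:
  fixes A :: "real^'n^'n"
  shows "((\<lambda>s. mexp (s *\<^sub>R A) $ i $ j) has_real_derivative (A ** mexp (s *\<^sub>R A)) $ i $ j) (at s)"
proof -
  \<comment> \<open>The factor k + 1 produced by \<open>diffs\<close> cancels against
    \<open>fact (Suc k)\<close>, leaving the coefficients of A exp(sA).\<close>
  have "(\<lambda>k. diffs (\<lambda>k. mpow A k $ i $ j / fact k) k * s ^ k)
      = (\<lambda>k. mpow A (Suc k) $ i $ j / fact k * s ^ k)"
    by (auto simp: diffs_def fun_eq_iff simp del: mpow.simps)
  with termdiffs_strong_converges_everywhere[OF summable_mexp[of A i j], of s] show ?thesis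
    by (simp add: mexp_scaleR_nth mult_mexp_nth)
qed

lemma mexp_0: "mexp (0::real^'n^'n) = mat 1"
proof -
  have "(\<Sum>k. mpow 0 k $ i $ j / fact k * 0 ^ k) = (mat 1 :: real^'n^'n) $ i $ j" for i j
    by (subst powser_zero) simp
  then show ?thesis
    using mexp_scaleR_nth[of 0 "0::real^'n^'n"] by (simp add: vec_eq_iff)
qed

section \<open>Spectral gap of the Laplacian\<close>

lemma sum_nbrs: "(\<Sum>j\<in>nbrs adj i. g j) = (\<Sum>j\<in>UNIV. if adj i j then g j else (0::real))"
  for adj :: "'n::finite \<Rightarrow> 'n \<Rightarrow> bool"
  by (simp add: nbrs_def sum.If_cases)

lemma laplacian_mult_nth:
  fixes adj :: "'n::finite \<Rightarrow> 'n \<Rightarrow> bool"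
  assumes "undirected_graph adj"
  shows "(laplacian adj *v y) $ i = (\<Sum>j\<in>nbrs adj i. y $ i - y $ j)"
proof -
  have "(laplacian adj *v y) $ i
      = (\<Sum>j\<in>UNIV. (if i = j then real (degree adj i) * y $ j else 0) - (if adj i j then y $ j else 0))"
    using assms unfolding laplacian_def matrix_vector_mult_def undirected_graph_def
    by (auto intro!: sum.cong)
  also have "\<dots> = real (degree adj i) * y $ i - (\<Sum>j\<in>nbrs adj i. y $ j)"
    by (simp add: sum_subtractf sum_nbrs)
  finally show ?thesis
    by (simp add: sum_subtractf degree_def)
qed

lemma inner_laplacian_commute:
  fixes adj :: "'n::finite \<Rightarrow> 'n \<Rightarrow> bool"
  assumes "undirected_graph adj"
  shows "x \<bullet> (laplacian adj *v y) = (laplacian adj *v x) \<bullet> y"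
proof -
  have "transpose (laplacian adj) = laplacian adj"
    using assms by (auto simp: undirected_graph_def transpose_def laplacian_def vec_eq_iff)
  then have "x v* laplacian adj = laplacian adj *v x"
    by (metis transpose_matrix_vector)
  then show ?thesis
    by (metis dot_lmul_matrix)
qed

lemma laplacian_const:
  fixes adj :: "'n::finite \<Rightarrow> 'n \<Rightarrow> bool"
  assumes "undirected_graph adj"
  shows "laplacian adj *v (\<chi> i. c) = 0"
  by (simp add: vec_eq_iff laplacian_mult_nth[OF assms])

lemma sum_laplacian_mult:
  fixes adj :: "'n::finite \<Rightarrow> 'n \<Rightarrow> bool"
  assumes "undirected_graph adj"
  shows "(\<Sum>i\<in>UNIV. (laplacian adj *v y) $ i) = 0"
  using inner_laplacian_commute[OF assms, of "\<chi> i. 1" y]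
  by (simp add: laplacian_const[OF assms] inner_vec_def)

lemma laplacian_quadratic_form:
  fixes adj :: "'n::finite \<Rightarrow> 'n \<Rightarrow> bool"
  assumes "undirected_graph adj"
  shows "y \<bullet> (laplacian adj *v y) = (\<Sum>i\<in>UNIV. \<Sum>j\<in>nbrs adj i. (y $ i - y $ j)\<^sup>2) / 2"
proof -
  define a :: "'n \<Rightarrow> 'n \<Rightarrow> real" where "a i j = (if adj i j then 1 else 0)" for i j
  have a: "a i j = a j i" for i j
    using assms by (simp add: a_def undirected_graph_def)
  have nb: "(\<Sum>j\<in>nbrs adj i. g j) = (\<Sum>j\<in>UNIV. a i j * g j)" for i and g :: "'n \<Rightarrow> real"
    unfolding sum_nbrs by (auto simp: a_def intro!: sum.cong)
  define S where "S = (\<Sum>i\<in>UNIV. \<Sum>j\<in>UNIV. a i j * (y $ i * (y $ i - y $ j)))"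
  have "y \<bullet> (laplacian adj *v y) = S"
    by (simp add: inner_vec_def laplacian_mult_nth[OF assms] nb S_def sum_distrib_left mult.left_commute)
  \<comment> \<open>Exchanging the two ends of each edge and adding both versions completes the
    square.\<close>
  moreover have "S = (\<Sum>i\<in>UNIV. \<Sum>j\<in>UNIV. a i j * (y $ j * (y $ j - y $ i)))"
    unfolding S_def by (subst sum.swap) (simp add: a)
  then have "2 * S = (\<Sum>i\<in>UNIV. \<Sum>j\<in>UNIV. a i j * (y $ i * (y $ i - y $ j)) + a i j * (y $ j * (y $ j - y $ i)))"
    by (simp add: sum.distrib S_def)
  then have "2 * S = (\<Sum>i\<in>UNIV. \<Sum>j\<in>nbrs adj i. (y $ i - y $ j)\<^sup>2)"
    unfolding nb by (simp add: algebra_simps power2_eq_square)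
  ultimately show ?thesis by simp
qed

lemma laplacian_nonneg:
  fixes adj :: "'n::finite \<Rightarrow> 'n \<Rightarrow> bool"
  assumes "undirected_graph adj"
  shows "0 \<le> y \<bullet> (laplacian adj *v y)"
  unfolding laplacian_quadratic_form[OF assms] by (intro divide_nonneg_nonneg sum_nonneg) auto

text \<open>A vanishing sum of squares forces y to agree across every edge, hence along every path;
  a constant vector with zero sum is zero.\<close>

lemma laplacian_definite:
  fixes adj :: "'n::finite \<Rightarrow> 'n \<Rightarrow> bool"
  assumes "undirected_graph adj" "connected_graph adj"
    and "y \<bullet> (laplacian adj *v y) = 0" and "(\<Sum>i\<in>UNIV. y $ i) = 0"
  shows "y = 0"
proof -
  have "(\<Sum>j\<in>nbrs adj i. (y $ i - y $ j)\<^sup>2) = 0" for i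
    using assms(3) unfolding laplacian_quadratic_form[OF assms(1)]
    by (simp add: sum_nonneg_eq_0_iff sum_nonneg)
  then have adj: "y $ i = y $ j" if "adj i j" for i j
    using that by (simp add: sum_nonneg_eq_0_iff nbrs_def)
  have const: "y $ i = y $ j" for i j
  proof -
    have "(i, j) \<in> {(a, b). adj a b}\<^sup>*"
      using assms(2) by (simp add: connected_graph_def)
    then show ?thesis by induction (auto dest: adj)
  qed
  have "y $ i = 0" for i
  proof -
    have "(\<Sum>j\<in>UNIV. y $ j) = (\<Sum>j\<in>(UNIV::'n set). y $ i)"
      by (intro sum.cong const) auto
    with assms(4) show ?thesis by simp
  qed
  then show ?thesis by (simp add: vec_eq_iff)
qed

text \<open>First-order optimality condition: near e = 0 the linear term would dominate and take
  both signs.\<close>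

lemma linear_coeff_eq_0:
  fixes b c :: real
  assumes "\<And>e. 0 \<le> 2 * e * b + e\<^sup>2 * c"
  shows "b = 0"
proof (rule ccontr)
  assume "b \<noteq> 0"
  \<comment> \<open>The choice makes k positive and larger than c/2, so at e = -b/k the quadratic
    term cannot compensate the linear one.\<close>
  define k where "k = \<bar>c\<bar> + 1"
  have k: "k > 0" "c < 2 * k" by (auto simp: k_def)
  have "2 * (- b / k) * b + (- b / k)\<^sup>2 * c = b\<^sup>2 / k\<^sup>2 * (c - 2 * k)"
    using k(1) by (simp add: power2_eq_square field_simps)
  also have "\<dots> < 0"
    using k \<open>b \<noteq> 0\<close> by (intro mult_pos_neg) auto
  finally show False
    using assms[of "- b / k"] by simp
qed

lemma infnorm_le_cart:
  fixes y :: "real^'n"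
  assumes "\<And>i. \<bar>y $ i\<bar> \<le> c"
  shows "infnorm y \<le> c"
  unfolding infnorm_cart using assms by (intro cSup_least) auto

text \<open>The difference of two unit vectors. It shows that the zero-sum space is nontrivial and
  later serves as the test vector for \<Gamma> \<ge> 1.\<close>

lemma zero_sum_vector_exists:
  assumes "CARD('n::finite) \<ge> 2"
  obtains w :: "real^'n" where "(\<Sum>i\<in>UNIV. w $ i) = 0" "infnorm w = 1"
proof -
  have "\<not> CARD('n) \<le> Suc 0" using assms by simp
  then obtain a b :: 'n where "a \<noteq> b"
    by (auto simp: card_le_Suc0_iff_eq)
  define w :: "real^'n" where "w = axis a 1 - axis b 1"
  have "w $ a = 1" using \<open>a \<noteq> b\<close> by (simp add: w_def axis_def)
  then have "1 \<le> infnorm w"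
    using component_le_infnorm_cart[of w a] by simp
  moreover have "infnorm w \<le> 1"
    by (rule infnorm_le_cart) (auto simp: w_def axis_def)
  moreover have "(\<Sum>i\<in>UNIV. w $ i) = 0"
    by (simp add: w_def axis_def sum_subtractf)
  ultimately show ?thesis using that by force
qed

text \<open>The minimiser of the Rayleigh quotient on the orthogonal complement of the constants is an
  eigenvector, so no spectral theorem is needed to identify the decay rate.\<close>

lemma laplacian_spectral_gap:
  fixes adj :: "'n::finite \<Rightarrow> 'n \<Rightarrow> bool"
  assumes "undirected_graph adj" "connected_graph adj" "CARD('n) \<ge> 2"
  obtains \<mu> v where "\<mu> > 0" "v \<noteq> 0" "laplacian adj *v v = \<mu> *\<^sub>R v"
    "\<And>y. (\<Sum>i\<in>UNIV. y $ i) = 0 \<Longrightarrow> \<mu> * (y \<bullet> y) \<le> y \<bullet> (laplacian adj *v y)"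
proof -
  let ?L = "laplacian adj"
  define K where "K = {y::real^'n. (\<Sum>i\<in>UNIV. y $ i) = 0} \<inter> sphere 0 1"
  have "compact K"
    unfolding K_def
    by (intro closed_Int_compact closed_Collect_eq continuous_intros compact_sphere)
  obtain w :: "real^'n" where w: "(\<Sum>i\<in>UNIV. w $ i) = 0" "infnorm w = 1"
    using zero_sum_vector_exists[OF assms(3)] .
  then have "w \<noteq> 0" by (auto simp: infnorm_0)
  then have "(1 / norm w) *\<^sub>R w \<in> K"
    using w by (simp add: K_def sum_divide_distrib[symmetric])
  then have "K \<noteq> {}" by blast
  have "continuous_on K (\<lambda>y. y \<bullet> (?L *v y))"
    by (intro continuous_intros matrix_vector_mult_linear_continuous_on)
  then obtain v where v: "v \<in> K" "\<And>y. y \<in> K \<Longrightarrow> v \<bullet> (?L *v v) \<le> y \<bullet> (?L *v y)"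
    using continuous_attains_inf[OF \<open>compact K\<close> \<open>K \<noteq> {}\<close>] by blast
  define \<mu> where "\<mu> = v \<bullet> (?L *v v)"
  have sv: "(\<Sum>i\<in>UNIV. v $ i) = 0" and nv: "norm v = 1" using v(1) by (auto simp: K_def)
  have vv: "v \<bullet> v = 1" using nv by (simp add: norm_eq_1)
  have "v \<noteq> 0" using nv by auto
  have gap: "\<mu> * (y \<bullet> y) \<le> y \<bullet> (?L *v y)" if "(\<Sum>i\<in>UNIV. y $ i) = 0" for y
  proof (cases "y = 0")
    case False
    then have "(1 / norm y) *\<^sub>R y \<in> K"
      using that by (simp add: K_def sum_divide_distrib[symmetric])
    from v(2)[OF this] have "\<mu> \<le> (y \<bullet> (?L *v y)) / (norm y)\<^sup>2"
      by (simp add: \<mu>_def matrix_vector_mult_scaleR power2_eq_square)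
    then show ?thesis
      using False by (simp add: field_simps power2_norm_eq_inner)
  qed simp
  have "\<mu> \<noteq> 0"
    using laplacian_definite[OF assms(1,2), of v] sv \<open>v \<noteq> 0\<close> by (auto simp: \<mu>_def)
  then have "\<mu> > 0"
    using laplacian_nonneg[OF assms(1), of v] by (simp add: \<mu>_def)
  \<comment> \<open>The residual h again has zero sum, so v + e h is an admissible competitor for
    every e. Minimality then yields a quadratic inequality in e with linear coefficient 2 (h
    \<bullet> h), which forces h = 0.\<close>
  define h where "h = ?L *v v - \<mu> *\<^sub>R v"
  have sh: "(\<Sum>i\<in>UNIV. h $ i) = 0"
    by (simp add: h_def sum_subtractf sum_laplacian_mult[OF assms(1)] sum_distrib_left[symmetric] sv)
  have "0 \<le> 2 * e * (h \<bullet> h) + e\<^sup>2 * (h \<bullet> (?L *v h) - \<mu> * (h \<bullet> h))" for e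
  proof -
    have "(\<Sum>i\<in>UNIV. (v + e *\<^sub>R h) $ i) = 0"
      by (simp add: sum.distrib sum_distrib_left[symmetric] sv sh)
    from gap[OF this]
    have "\<mu> * (v \<bullet> v + 2 * e * (v \<bullet> h) + e\<^sup>2 * (h \<bullet> h))
        \<le> \<mu> + 2 * e * (h \<bullet> (?L *v v)) + e\<^sup>2 * (h \<bullet> (?L *v h))"
      using inner_laplacian_commute[OF assms(1), of v h]
      by (simp add: matrix_vector_right_distrib matrix_vector_mult_scaleR inner_add_left inner_add_right
          \<mu>_def[symmetric] inner_commute power2_eq_square algebra_simps)
    moreover have "h \<bullet> (?L *v v) = h \<bullet> h + \<mu> * (v \<bullet> h)"
      by (subst (3) h_def) (simp add: inner_diff_right inner_commute)
    ultimately have "\<mu> * (1 + 2 * e * (v \<bullet> h) + e\<^sup>2 * (h \<bullet> h))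
        \<le> \<mu> + 2 * e * (h \<bullet> h + \<mu> * (v \<bullet> h)) + e\<^sup>2 * (h \<bullet> (?L *v h))"
      by (simp only: vv)
    then show ?thesis by (simp add: algebra_simps)
  qed
  then have "h \<bullet> h = 0" by (rule linear_coeff_eq_0)
  then have "?L *v v = \<mu> *\<^sub>R v" by (simp add: h_def)
  with that \<open>\<mu> > 0\<close> \<open>v \<noteq> 0\<close> gap show ?thesis by blast
qed

section \<open>Characteristic polynomial and the second smallest eigenvalue\<close>

lemma poly_charpoly: "poly (charpoly A) r = det (mat r - A)"
  unfolding charpoly_def det_def
  by (auto simp: poly_sum poly_prod mat_def intro!: sum.cong prod.cong)

lemma poly_charpoly_eq_0_iff:
  fixes A :: "real^'n^'n"
  shows "poly (charpoly A) r = 0 \<longleftrightarrow> (\<exists>v. v \<noteq> 0 \<and> A *v v = r *\<^sub>R v)"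
proof -
  have "mat r *v v = r *\<^sub>R v" for v :: "real^'n"
    by (simp add: vec_eq_iff matrix_vector_mult_def mat_def if_distrib[of "\<lambda>x. x * _"] cong: if_cong)
  then have eq: "(mat r - A) *v v = 0 \<longleftrightarrow> A *v v = r *\<^sub>R v" for v
    by (auto simp: matrix_vector_mult_diff_rdistrib)
  have "det (mat r - A) \<noteq> 0 \<longleftrightarrow> (\<forall>v. (mat r - A) *v v = 0 \<longrightarrow> v = 0)"
    by (metis invertible_det_nz invertible_left_inverse matrix_left_invertible_ker)
  then show ?thesis unfolding poly_charpoly eq by blast
qed

text \<open>Two distinct roots contribute multiplicity at least 2, so s meets the defining
  condition. For \<open>LEAST\<close> over the reals to be attained, the condition is reduced to the
  finitely many roots up to s: the count jumps only at roots.\<close>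

lemma lambda2_le:
  assumes nz: "charpoly A \<noteq> 0" and roots: "poly (charpoly A) r = 0" "poly (charpoly A) s = 0" "r < s"
  shows "lambda2 A \<le> s"
proof -
  define Z where "Z \<mu> = {r. poly (charpoly A) r = 0 \<and> r \<le> \<mu>}" for \<mu>
  define P where "P \<mu> \<longleftrightarrow> 2 \<le> (\<Sum>r\<in>Z \<mu>. order r (charpoly A))" for \<mu>
  have fin: "finite (Z \<mu>)" for \<mu>
    unfolding Z_def using poly_roots_finite[OF nz] by (rule rev_finite_subset) auto
  have ord: "1 \<le> order t (charpoly A)" if "poly (charpoly A) t = 0" for t
    using that nz by (simp add: order_root Suc_le_eq)
  have "2 \<le> (\<Sum>t\<in>{r, s}. order t (charpoly A))"
    using roots ord[of r] ord[of s] by simp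
  also have "\<dots> \<le> (\<Sum>t\<in>Z s. order t (charpoly A))"
    using roots by (intro sum_mono2 fin) (auto simp: Z_def)
  finally have "P s" by (simp add: P_def)
  have root_below: "\<exists>\<nu>\<in>Z \<mu>. P \<nu>" if "P \<mu>" for \<mu>
  proof -
    have ne: "Z \<mu> \<noteq> {}" using that by (auto simp: P_def)
    \<comment> \<open>Lowering the threshold from \<mu> to the largest root below it discards no
      root.\<close>
    have "Z (Max (Z \<mu>)) = Z \<mu>"
      using Max_in[OF fin ne] Max_ge[OF fin] unfolding Z_def by fastforce
    with that have "P (Max (Z \<mu>))" by (simp add: P_def)
    with Max_in[OF fin ne] show ?thesis by blast
  qed
  define C where "C = {\<nu>\<in>Z s. P \<nu>}"
  have "finite C" using fin by (simp add: C_def)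
  have "C \<noteq> {}" using root_below[OF \<open>P s\<close>] by (auto simp: C_def)
  define m where "m = Min C"
  have "m \<in> C" using Min_in[OF \<open>finite C\<close> \<open>C \<noteq> {}\<close>] by (simp add: m_def)
  have "m \<le> \<mu>" if P\<mu>: "P \<mu>" for \<mu>
  proof (cases "\<mu> \<le> s")
    case True
    obtain \<nu> where "\<nu> \<in> Z \<mu>" "P \<nu>" using root_below[OF P\<mu>] by blast
    then have "\<nu> \<in> C" "\<nu> \<le> \<mu>" using True by (auto simp: C_def Z_def)
    then show ?thesis using Min_le[OF \<open>finite C\<close>] by (fastforce simp: m_def)
  next
    case False
    then show ?thesis using \<open>m \<in> C\<close> by (auto simp: C_def Z_def)
  qed
  then have "(LEAST \<mu>. P \<mu>) = m"
    using \<open>m \<in> C\<close> by (intro Least_equality) (auto simp: C_def)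
  then show ?thesis
    using \<open>m \<in> C\<close> unfolding lambda2_def P_def Z_def C_def by auto
qed

text \<open>The constants supply the eigenvalue 0 and v supplies \<mu>. The characteristic
  polynomial is nonzero because -1 cannot be an eigenvalue of a positive semidefinite
  matrix.\<close>

lemma lambda2_laplacian_le:
  fixes adj :: "'n::finite \<Rightarrow> 'n \<Rightarrow> bool"
  assumes "undirected_graph adj" "\<mu> > 0" "v \<noteq> 0" "laplacian adj *v v = \<mu> *\<^sub>R v"
  shows "lambda2 (laplacian adj) \<le> \<mu>"
proof (rule lambda2_le[where r = 0 and s = \<mu>])
  show "poly (charpoly (laplacian adj)) \<mu> = 0"
    unfolding poly_charpoly_eq_0_iff using assms by blast
  have "(\<chi> i. 1) \<noteq> (0::real^'n)" by (simp add: vec_eq_iff)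
  then show "poly (charpoly (laplacian adj)) 0 = 0"
    unfolding poly_charpoly_eq_0_iff using laplacian_const[OF assms(1), of 1] by (metis scaleR_zero_left)
  have "laplacian adj *v w \<noteq> (-1) *\<^sub>R w" if "w \<noteq> 0" for w
    using laplacian_nonneg[OF assms(1), of w] that inner_gt_zero_iff[of w] by (auto simp del: inner_gt_zero_iff)
  then have "poly (charpoly (laplacian adj)) (-1) \<noteq> 0"
    unfolding poly_charpoly_eq_0_iff by blast
  then show "charpoly (laplacian adj) \<noteq> 0" by auto
qed (rule assms)

section \<open>Decay of the heat semigroup\<close>

lemma avg_mat_mult: "avg_mat *v y = (\<chi> i. (\<Sum>j\<in>UNIV. y $ j) / real CARD('n))"
  for y :: "real^'n"
  by (simp add: avg_mat_def matrix_vector_mult_def vec_eq_iff sum_divide_distrib)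

lemma DERIV_mexp_minus:
  fixes A :: "real^'n^'n"
  shows "((\<lambda>t. mexp (- (t *\<^sub>R A)) $ i $ j) has_real_derivative - (A ** mexp (- (t *\<^sub>R A))) $ i $ j) (at t)"
  using DERIV_chain2[OF DERIV_mexp[of A i j "- t"] DERIV_minus[OF DERIV_ident]]
  by simp

lemma mexp_minus_commute: "A ** mexp (- (t *\<^sub>R A)) = mexp (- (t *\<^sub>R A)) ** A"
  for A :: "real^'n^'n"
  using mexp_commute[of A "- t"] by simp

text \<open>The semigroup fixes constants: L commutes with its exponential and kills constants, so
  the row sums keep their value at t = 0.\<close>

lemma mexp_laplacian_row_sum:
  fixes adj :: "'n::finite \<Rightarrow> 'n \<Rightarrow> bool"
  assumes "undirected_graph adj"
  shows "(\<Sum>j\<in>UNIV. mexp (- (t *\<^sub>R laplacian adj)) $ i $ j) = 1"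
proof -
  let ?L = "laplacian adj"
  let ?M = "\<lambda>t. mexp (- (t *\<^sub>R ?L))"
  have "(\<Sum>j\<in>UNIV. (?L ** ?M t) $ i $ j) = 0" for t
  proof -
    have "(\<Sum>j\<in>UNIV. (?L ** ?M t) $ i $ j) = ((?M t ** ?L) *v (\<chi> i. 1)) $ i"
      unfolding mexp_minus_commute by (simp add: matrix_vector_mult_def)
    also have "\<dots> = 0"
      by (simp add: matrix_vector_mul_assoc[symmetric] laplacian_const[OF assms])
    finally show ?thesis .
  qed
  then have "((\<lambda>t. \<Sum>j\<in>UNIV. ?M t $ i $ j) has_real_derivative 0) (at t)" for t
    by (auto intro!: derivative_eq_intros DERIV_mexp_minus simp: sum_negf)
  then have "(\<Sum>j\<in>UNIV. ?M t $ i $ j) = (\<Sum>j\<in>UNIV. ?M 0 $ i $ j)"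
    by (intro DERIV_isconst_all) auto
  then show ?thesis by (simp add: mexp_0 mat_def)
qed

text \<open>The semigroup preserves the total, since the columns of L sum to zero.\<close>

lemma mexp_laplacian_col_sum:
  fixes adj :: "'n::finite \<Rightarrow> 'n \<Rightarrow> bool"
  assumes "undirected_graph adj"
  shows "(\<Sum>i\<in>UNIV. mexp (- (t *\<^sub>R laplacian adj)) $ i $ j) = 1"
proof -
  let ?L = "laplacian adj"
  let ?M = "\<lambda>t. mexp (- (t *\<^sub>R ?L))"
  have "(\<Sum>i\<in>UNIV. (?L ** ?M t) $ i $ j) = 0" for t
    using sum_laplacian_mult[OF assms, of "column j (?M t)"]
    by (simp add: matrix_matrix_mult_def matrix_vector_mult_def column_def)
  then have "((\<lambda>t. \<Sum>i\<in>UNIV. ?M t $ i $ j) has_real_derivative 0) (at t)" for t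
    by (auto intro!: derivative_eq_intros DERIV_mexp_minus simp: sum_negf)
  then have "(\<Sum>i\<in>UNIV. ?M t $ i $ j) = (\<Sum>i\<in>UNIV. ?M 0 $ i $ j)"
    by (intro DERIV_isconst_all) auto
  then show ?thesis by (simp add: mexp_0 mat_def)
qed

text \<open>The deviation z from the average solves z' = -L z and keeps zero sum, so the gap
  inequality makes the weighted energy V nonincreasing.\<close>

lemma mexp_laplacian_decay:
  fixes adj :: "'n::finite \<Rightarrow> 'n \<Rightarrow> bool"
  assumes graph: "undirected_graph adj" and "0 \<le> t"
    and gap: "\<And>y. (\<Sum>i\<in>UNIV. y $ i) = 0 \<Longrightarrow> \<mu> * (y \<bullet> y) \<le> y \<bullet> (laplacian adj *v y)"
  shows "norm ((mexp (- (t *\<^sub>R laplacian adj)) - avg_mat) *v x)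
    \<le> exp (- \<mu> * t) * norm ((mat 1 - avg_mat) *v x)"
proof -
  let ?L = "laplacian adj"
  let ?M = "\<lambda>t. mexp (- (t *\<^sub>R ?L))"
  define z where "z t = (?M t - avg_mat) *v x" for t
  have Lz: "?L *v z t = (?L ** ?M t) *v x" for t
    by (simp add: z_def matrix_vector_mult_diff_rdistrib matrix_vector_mult_diff_distrib
        matrix_vector_mul_assoc avg_mat_mult[of x] laplacian_const[OF graph])
  have dz: "((\<lambda>t. z t $ i) has_real_derivative - (?L *v z t) $ i) (at t)" for i t
  proof -
    have "((\<lambda>t. \<Sum>j\<in>UNIV. (?M t $ i $ j - avg_mat $ i $ j) * x $ j)
        has_real_derivative (\<Sum>j\<in>UNIV. - (?L ** ?M t) $ i $ j * x $ j)) (at t)"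
      by (rule DERIV_sum) (auto intro!: derivative_eq_intros DERIV_mexp_minus)
    then show ?thesis
      unfolding Lz by (simp add: z_def matrix_vector_mult_def sum_negf)
  qed
  have sz: "(\<Sum>i\<in>UNIV. z t $ i) = 0" for t
  proof -
    have "(\<Sum>i\<in>UNIV. (?M t *v x) $ i) = (\<Sum>j\<in>UNIV. (\<Sum>i\<in>UNIV. ?M t $ i $ j) * x $ j)"
      unfolding matrix_vector_mult_def by (subst sum_distrib_right, subst sum.swap) simp
    then show ?thesis
      by (simp add: z_def matrix_vector_mult_diff_rdistrib avg_mat_mult sum_subtractf
          mexp_laplacian_col_sum[OF graph])
  qed
  define V where "V t = exp (2 * \<mu> * t) * (\<Sum>i\<in>UNIV. (z t $ i)\<^sup>2)" for t
  have zz: "(\<Sum>i\<in>UNIV. (z t $ i)\<^sup>2) = z t \<bullet> z t" for t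
    by (simp add: inner_vec_def power2_eq_square)
  have "V t \<le> V 0"
  proof (rule DERIV_nonpos_imp_nonincreasing[OF \<open>0 \<le> t\<close>])
    fix s
    have "(V has_real_derivative
        exp (2 * \<mu> * s) * (2 * \<mu>) * (\<Sum>i\<in>UNIV. (z s $ i)\<^sup>2)
        + exp (2 * \<mu> * s) * (\<Sum>i\<in>UNIV. 2 * z s $ i * - (?L *v z s) $ i)) (at s)"
      unfolding V_def
      by (auto intro!: derivative_eq_intros dz simp: algebra_simps)
    moreover have "(\<Sum>i\<in>UNIV. 2 * z s $ i * - (?L *v z s) $ i) = - 2 * (z s \<bullet> (?L *v z s))"
      by (simp add: inner_vec_def sum_distrib_left sum_negf mult.assoc)
    moreover have "exp (2 * \<mu> * s) * (2 * \<mu>) * (z s \<bullet> z s)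
        + exp (2 * \<mu> * s) * (- 2 * (z s \<bullet> (?L *v z s))) \<le> 0"
      using mult_left_mono[OF gap[OF sz[of s]], of "2 * exp (2 * \<mu> * s)"] by (simp add: algebra_simps)
    ultimately show "\<exists>y. DERIV V s :> y \<and> y \<le> 0"
      unfolding zz by metis
  qed
  then have "(exp (\<mu> * t) * norm (z t))\<^sup>2 \<le> (norm (z 0))\<^sup>2"
    by (simp add: V_def zz power_mult_distrib power2_norm_eq_inner exp_double[symmetric] mult.assoc)
  then have "exp (\<mu> * t) * norm (z t) \<le> norm (z 0)"
    by (rule power2_le_imp_le) simp
  then show ?thesis
    by (simp add: z_def mexp_0 exp_minus field_simps)
qed

section \<open>The induced maximum norm and finiteness of \<Gamma>\<close>

lemma infnorm_matrix_vector_mult_le: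
  fixes A :: "real^'n^'n"
  assumes "infnorm x \<le> 1"
  shows "infnorm (A *v x) \<le> (\<Sum>i\<in>UNIV. \<Sum>j\<in>UNIV. \<bar>A $ i $ j\<bar>)"
proof (rule infnorm_le_cart)
  fix i
  have "\<bar>(A *v x) $ i\<bar> \<le> (\<Sum>j\<in>UNIV. \<bar>A $ i $ j\<bar> * \<bar>x $ j\<bar>)"
    by (simp add: matrix_vector_mult_def) (metis (no_types, lifting) abs_mult sum.cong sum_abs)
  also have "\<dots> \<le> (\<Sum>j\<in>UNIV. \<bar>A $ i $ j\<bar>)"
    using order_trans[OF component_le_infnorm_cart assms]
    by (intro sum_mono mult_left_le) auto
  also have "\<dots> \<le> (\<Sum>i\<in>UNIV. \<Sum>j\<in>UNIV. \<bar>A $ i $ j\<bar>)"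
    by (rule member_le_sum[of i UNIV "\<lambda>i. \<Sum>j\<in>UNIV. \<bar>A $ i $ j\<bar>"]) (auto intro!: sum_nonneg)
  finally show "\<bar>(A *v x) $ i\<bar> \<le> (\<Sum>i\<in>UNIV. \<Sum>j\<in>UNIV. \<bar>A $ i $ j\<bar>)" .
qed

lemma infnorm_mult_le_mnorm_inf:
  fixes A :: "real^'n^'n"
  shows "infnorm (A *v x) \<le> mnorm_inf A * infnorm x"
proof (cases "x = 0")
  case True
  then show ?thesis by (simp add: infnorm_0)
next
  case False
  then have pos: "infnorm x > 0" by (simp add: infnorm_pos_lt)
  have "infnorm (A *v ((1 / infnorm x) *\<^sub>R x)) \<le> mnorm_inf A"
    unfolding mnorm_inf_def
  proof (rule cSup_upper)
    have "infnorm ((1 / infnorm x) *\<^sub>R x) \<le> 1"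
      using pos by (simp add: infnorm_mul)
    then show "infnorm (A *v ((1 / infnorm x) *\<^sub>R x)) \<in> {infnorm (A *v x) |x. infnorm x \<le> 1}"
      by blast
    show "bdd_above {infnorm (A *v x) |x. infnorm x \<le> 1}"
      by (intro bdd_aboveI) (auto intro: infnorm_matrix_vector_mult_le)
  qed
  then show ?thesis
    using pos by (simp add: matrix_vector_mult_scaleR infnorm_mul field_simps)
qed

lemma mnorm_inf_le:
  fixes A :: "real^'n^'n"
  assumes "\<And>x. infnorm x \<le> 1 \<Longrightarrow> infnorm (A *v x) \<le> c"
  shows "mnorm_inf A \<le> c"
proof -
  have "infnorm (0::real^'n) \<le> 1" by (simp add: infnorm_0)
  then show ?thesis
    unfolding mnorm_inf_def using assms by (intro cSup_least) blast+
qed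

text \<open>Since \<gamma> \<le> \<lambda>2 \<le> \<mu>, the Euclidean decay estimate bounds the
  weighted family uniformly in t \<ge> 0, so the supremum dominates each member. For \<Gamma> \<ge>
  1, take t = 0 and a zero-sum vector, which I - avg leaves unchanged.\<close>

lemma Gamma_inf_laplacian:
  fixes adj :: "'n::finite \<Rightarrow> 'n \<Rightarrow> bool"
  assumes graph: "undirected_graph adj" "connected_graph adj" "CARD('n) \<ge> 2"
    and \<gamma>: "\<gamma> \<le> lambda2 (laplacian adj)"
  shows "t \<ge> 0 \<Longrightarrow> infnorm ((mexp (- (t *\<^sub>R laplacian adj)) - avg_mat) *v x)
      \<le> Gamma_inf \<gamma> (laplacian adj) * exp (- \<gamma> * t) * infnorm x"
    and "1 \<le> Gamma_inf \<gamma> (laplacian adj)"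
proof -
  let ?L = "laplacian adj"
  let ?D = "\<lambda>t. mexp (- (t *\<^sub>R ?L)) - avg_mat"
  let ?\<Gamma> = "Gamma_inf \<gamma> ?L"
  obtain \<mu> v where \<mu>: "\<mu> > 0" "v \<noteq> 0" "?L *v v = \<mu> *\<^sub>R v"
    and gap: "\<And>y. (\<Sum>i\<in>UNIV. y $ i) = 0 \<Longrightarrow> \<mu> * (y \<bullet> y) \<le> y \<bullet> (?L *v y)"
    using laplacian_spectral_gap[OF graph] by blast
  have "\<gamma> \<le> \<mu>"
    using \<gamma> lambda2_laplacian_le[OF graph(1) \<mu>] by simp
  have scale: "infnorm ((exp (\<gamma> * t) *\<^sub>R ?D t) *v y) = exp (\<gamma> * t) * infnorm (?D t *v y)" for t y
    by (simp add: scaleR_matrix_vector_assoc[symmetric] infnorm_mul)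
  \<comment> \<open>Euclidean operator norm of I - avg, times the constant for passing from the
    Euclidean to the maximum norm. What counts is that it is independent of t.\<close>
  let ?K = "onorm ((*v) (mat 1 - avg_mat :: real^'n^'n)) * sqrt DIM(real^'n)"
  have bound: "mnorm_inf (exp (\<gamma> * t) *\<^sub>R ?D t) \<le> ?K" if "t \<ge> 0" for t
  proof (rule mnorm_inf_le)
    fix y :: "real^'n" assume y: "infnorm y \<le> 1"
    have "infnorm (?D t *v y) \<le> norm (?D t *v y)"
      by (rule infnorm_le_norm)
    also have "\<dots> \<le> exp (- \<mu> * t) * norm ((mat 1 - avg_mat) *v y)"
      by (rule mexp_laplacian_decay[OF graph(1) that gap])
    finally have "exp (\<gamma> * t) * infnorm (?D t *v y)
        \<le> exp (\<gamma> * t) * (exp (- \<mu> * t) * norm ((mat 1 - avg_mat) *v y))"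
      by (intro mult_left_mono) auto
    also have "\<dots> = exp ((\<gamma> - \<mu>) * t) * norm ((mat 1 - avg_mat) *v y)"
      by (simp add: exp_add[symmetric] mult.assoc[symmetric] algebra_simps)
    also have "\<dots> \<le> 1 * norm ((mat 1 - avg_mat) *v y)"
      using \<open>\<gamma> \<le> \<mu>\<close> that by (intro mult_right_mono) (auto simp: mult_nonpos_nonneg)
    also have "\<dots> \<le> onorm ((*v) (mat 1 - avg_mat :: real^'n^'n)) * norm y"
      using onorm[OF matrix_vector_mul_bounded_linear] by simp
    also have "\<dots> \<le> onorm ((*v) (mat 1 - avg_mat :: real^'n^'n)) * (sqrt DIM(real^'n) * infnorm y)"
      by (intro mult_left_mono norm_le_infnorm onorm_pos_le matrix_vector_mul_bounded_linear)
    also have "\<dots> \<le> ?K"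
      unfolding mult.assoc[symmetric]
      by (intro mult_left_le y mult_nonneg_nonneg onorm_pos_le matrix_vector_mul_bounded_linear) simp
    finally show "infnorm ((exp (\<gamma> * t) *\<^sub>R ?D t) *v y) \<le> ?K"
      unfolding scale .
  qed
  have le: "mnorm_inf (exp (\<gamma> * t) *\<^sub>R ?D t) \<le> ?\<Gamma>" if "t \<ge> 0" for t
    unfolding Gamma_inf_def
  proof (rule cSUP_upper)
    show "bdd_above ((\<lambda>t. mnorm_inf (exp (\<gamma> * t) *\<^sub>R ?D t)) ` {0..})"
      using bound by (intro bdd_aboveI2[of _ _ ?K]) auto
  qed (use that in auto)
  have bnd: "exp (\<gamma> * t) * infnorm (?D t *v y) \<le> ?\<Gamma> * infnorm y" if "t \<ge> 0" for t y
    using infnorm_mult_le_mnorm_inf[of "exp (\<gamma> * t) *\<^sub>R ?D t" y]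
      mult_right_mono[OF le[OF that] infnorm_pos_le[of y]] unfolding scale by linarith
  show "infnorm (?D t *v x) \<le> ?\<Gamma> * exp (- \<gamma> * t) * infnorm x" if "t \<ge> 0"
    using bnd[OF that, of x] by (simp add: exp_minus field_simps)
  obtain w :: "real^'n" where w: "(\<Sum>i\<in>UNIV. w $ i) = 0" "infnorm w = 1"
    using zero_sum_vector_exists[OF graph(3)] .
  have "?D 0 *v w = w"
    by (simp add: mexp_0 matrix_vector_mult_diff_rdistrib avg_mat_mult w vec_eq_iff)
  with bnd[of 0 w] w show "1 \<le> ?\<Gamma>" by simp
qed

section \<open>Variation of constants\<close>

text \<open>A comparison principle that tolerates finitely many points without a derivative, as
  occur where the inputs jump.\<close>

lemma increment_le_of_derivative_le:
  fixes \<phi> \<phi>' B B' :: "real \<Rightarrow> real"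
  assumes "a \<le> b" "finite S" "continuous_on {a..b} \<phi>"
    and \<phi>: "\<And>s. s \<in> {a<..<b} - S \<Longrightarrow> (\<phi> has_real_derivative \<phi>' s) (at s)"
    and B: "\<And>s. (B has_real_derivative B' s) (at s)"
    and le: "\<And>s. s \<in> {a<..<b} - S \<Longrightarrow> \<phi>' s \<le> B' s"
  shows "\<phi> b - \<phi> a \<le> B b - B a"
proof -
  \<comment> \<open>Setting the integrand to B' at exceptional points and endpoints makes the
    comparison hold on all of [a, b] without changing the integral.\<close>
  let ?h = "\<lambda>s. if s \<in> {a<..<b} - S then \<phi>' s else B' s"
  have "(?h has_integral (\<phi> b - \<phi> a)) {a..b}"
    using assms(1-3) \<phi>
    by (intro fundamental_theorem_of_calculus_interior_strong[of S])
      (auto simp: has_real_derivative_iff_has_vector_derivative)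
  moreover have "(B' has_integral (B b - B a)) {a..b}"
    using B by (intro fundamental_theorem_of_calculus assms(1))
      (auto simp: has_real_derivative_iff_has_vector_derivative[symmetric] intro: has_field_derivative_at_within)
  ultimately show ?thesis
    by (rule has_integral_le) (use le in auto)
qed

text \<open>For fixed \<open>T\<close>, the map \<open>s \<mapsto> (exp (- (T - s) L) - avg) x(s)\<close> has derivative
  \<open>(exp (- (T - s) L) - avg) (L x + x')(s)\<close>, because the averaging matrix annihilates the Laplacian.\<close>

lemma consensus_error_bound:
  fixes adj :: "'n::finite \<Rightarrow> 'n \<Rightarrow> bool" and x u :: "'n \<Rightarrow> real \<Rightarrow> real"
  assumes graph: "undirected_graph adj" "connected_graph adj" "CARD('n) \<ge> 2"
    and \<gamma>: "\<gamma> \<le> lambda2 (laplacian adj)"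
    and \<Gamma>: "\<Gamma> = Gamma_inf \<gamma> (laplacian adj)"
    and init: "\<And>i. \<bar>x i 0 - (\<Sum>j\<in>UNIV. x j 0) / real CARD('n)\<bar> \<le> E0"
    and T: "0 \<le> T" and S: "finite S"
    and cont: "\<And>i. continuous_on {0..T} (x i)"
    and deriv: "\<And>i s. s \<in> {0<..<T} - S \<Longrightarrow> (x i has_real_derivative u i s) (at s)"
    and dist: "\<And>i s. s \<in> {0<..<T} - S \<Longrightarrow>
      \<bar>(\<Sum>j\<in>nbrs adj i. x i s - x j s) + u i s\<bar> \<le> (\<gamma> - \<omega>) * E0 * exp (- \<omega> * s)"
  shows "\<bar>x i T - (\<Sum>j\<in>UNIV. x j T) / real CARD('n)\<bar> \<le> \<Gamma> * E0 * exp (- \<omega> * T)"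
proof -
  let ?L = "laplacian adj"
  let ?D = "\<lambda>t. mexp (- (t *\<^sub>R ?L)) - avg_mat"
  define X where "X s = (\<chi> i. x i s)" for s
  define U where "U s = (\<chi> i. u i s)" for s
  define G where "G s = ?L *v X s + U s" for s
  define w where "w s = (?D (T - s) *v X s) $ i" for s
  note bound = Gamma_inf_laplacian(1)[OF graph \<gamma>, folded \<Gamma>]
  have \<Gamma>1: "1 \<le> \<Gamma>" using Gamma_inf_laplacian(2)[OF graph \<gamma>] \<Gamma> by simp
  have w_eq: "w s = (\<Sum>j\<in>UNIV. ?D (T - s) $ i $ j * x j s)" for s
    by (simp add: w_def X_def matrix_vector_mult_def)
  have dM: "((\<lambda>s. mexp (- ((T - s) *\<^sub>R ?L)) $ i $ j) has_real_derivative
      (?L ** mexp (- ((T - s) *\<^sub>R ?L))) $ i $ j) (at s)" for j s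
    using DERIV_chain2[OF DERIV_mexp_minus[of ?L i j "T - s"] DERIV_diff[OF DERIV_const DERIV_ident]]
    by simp
  have contw: "continuous_on {0..T} w"
  proof -
    have "continuous_on {0..T} (\<lambda>s. mexp (- ((T - s) *\<^sub>R ?L)) $ i $ j)" for j
      using dM by (meson DERIV_isCont continuous_at_imp_continuous_on)
    then show ?thesis
      unfolding w_eq[abs_def] vector_minus_component
      by (intro continuous_on_sum continuous_on_mult continuous_on_diff continuous_on_const cont)
  qed
  have dw: "(w has_real_derivative (?D (T - s) *v G s) $ i) (at s)" if "s \<in> {0<..<T} - S" for s
  proof -
    let ?M = "mexp (- ((T - s) *\<^sub>R ?L))"
    have "(w has_real_derivative (\<Sum>j\<in>UNIV. (?L ** ?M) $ i $ j * x j s + ?D (T - s) $ i $ j * u j s)) (at s)"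
      unfolding w_eq[abs_def]
      by (rule DERIV_sum) (auto intro!: derivative_eq_intros dM deriv[OF that])
    also have "(\<Sum>j\<in>UNIV. (?L ** ?M) $ i $ j * x j s + ?D (T - s) $ i $ j * u j s)
        = (?M *v (?L *v X s) + ?D (T - s) *v U s) $ i"
      unfolding mexp_minus_commute matrix_vector_mul_assoc
      by (simp add: matrix_vector_mult_def X_def U_def sum.distrib)
    also have "?M *v (?L *v X s) = ?D (T - s) *v (?L *v X s)"
      by (simp add: matrix_vector_mult_diff_rdistrib avg_mat_mult sum_laplacian_mult[OF graph(1)] vec_eq_iff)
    finally show ?thesis
      by (simp add: G_def matrix_vector_right_distrib)
  qed
  \<comment> \<open>Chosen so that B' is the bound on \<bar>w'\<bar>, while B 0 is the bound on
    \<bar>w 0\<bar> and B T is the claimed bound.\<close>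
  define B where "B s = \<Gamma> * E0 * exp (- \<gamma> * T) * exp ((\<gamma> - \<omega>) * s)" for s
  define B' where "B' s = \<Gamma> * E0 * exp (- \<gamma> * T) * (exp ((\<gamma> - \<omega>) * s) * (\<gamma> - \<omega>))" for s
  have dB: "(B has_real_derivative B' s) (at s)" for s
    unfolding B_def B'_def by (auto intro!: derivative_eq_intros)
  have leB: "\<bar>(?D (T - s) *v G s) $ i\<bar> \<le> B' s" if "s \<in> {0<..<T} - S" for s
  proof -
    have "infnorm (G s) \<le> (\<gamma> - \<omega>) * E0 * exp (- \<omega> * s)"
      using dist[OF that]
      by (intro infnorm_le_cart) (simp add: G_def U_def X_def laplacian_mult_nth[OF graph(1)])
    then have "\<Gamma> * exp (- \<gamma> * (T - s)) * infnorm (G s)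
        \<le> \<Gamma> * exp (- \<gamma> * (T - s)) * ((\<gamma> - \<omega>) * E0 * exp (- \<omega> * s))"
      using \<Gamma>1 by (intro mult_left_mono) auto
    also have "\<dots> = B' s"
      by (simp add: B'_def exp_add[symmetric] algebra_simps)
    finally show ?thesis
      using component_le_infnorm_cart[of "?D (T - s) *v G s" i] bound[of "T - s" "G s"] that by simp
  qed
  \<comment> \<open>Comparing both w and -w with B controls the absolute value.\<close>
  have "w T - w 0 \<le> B T - B 0"
    by (rule increment_le_of_derivative_le[OF T S contw dw dB]) (use leB in force)+
  moreover have "- w T - - w 0 \<le> B T - B 0"
    by (rule increment_le_of_derivative_le[OF T S continuous_on_minus[OF contw] DERIV_minus[OF dw] dB])
      (use leB in force)+
  ultimately have "\<bar>w T\<bar> \<le> \<bar>w 0\<bar> + (B T - B 0)" by linarith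
  moreover have "\<bar>w 0\<bar> \<le> B 0"
  proof -
    define c where "c = (\<Sum>j\<in>UNIV. x j 0) / real CARD('n)"
    \<comment> \<open>Both the semigroup and the averaging matrix fix constants, so only the initial
      deviation from the average c enters w 0.\<close>
    have "?D T *v (\<chi> j. c) = 0"
    proof -
      have "(mexp (- (T *\<^sub>R ?L)) *v (\<chi> j. c)) $ k = c" for k
        using mexp_laplacian_row_sum[OF graph(1), of T k]
        by (simp add: matrix_vector_mult_def sum_distrib_right[symmetric])
      then show ?thesis
        by (simp add: matrix_vector_mult_diff_rdistrib avg_mat_mult vec_eq_iff)
    qed
    then have "w 0 = (?D T *v (X 0 - (\<chi> j. c))) $ i"
      by (simp add: w_def matrix_vector_mult_diff_distrib)
    then have "\<bar>w 0\<bar> \<le> \<Gamma> * exp (- \<gamma> * T) * infnorm (X 0 - (\<chi> j. c))"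
      using component_le_infnorm_cart[of "?D T *v (X 0 - (\<chi> j. c))" i] bound[OF T, of "X 0 - (\<chi> j. c)"] by simp
    also have "\<dots> \<le> \<Gamma> * exp (- \<gamma> * T) * E0"
      using \<Gamma>1 init by (intro mult_left_mono infnorm_le_cart) (auto simp: X_def c_def)
    finally show ?thesis by (simp add: B_def mult_ac)
  qed
  moreover have "w T = x i T - (\<Sum>j\<in>UNIV. x j T) / real CARD('n)"
    by (simp add: w_def mexp_0 matrix_vector_mult_diff_rdistrib avg_mat_mult X_def)
  moreover have "B T = \<Gamma> * E0 * exp (- \<omega> * T)"
    by (simp add: B_def exp_add[symmetric] algebra_simps)
  ultimately show ?thesis by linarith
qed

section \<open>Sampling times and parameter conditions\<close>

text \<open>Applying the increasing map x exp x removes W from the definition of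
  \<open>\<omega>t\<close>; what remains after cancelling exp((\<eta> - \<omega>)\<tau>) is the rate
  condition used in the estimate.\<close>

lemma decay_rate_le:
  assumes "0 < \<tau>" "0 \<le> \<xi>" "\<omega> \<le> \<eta> - lambertW (\<xi> * \<tau> * exp (\<eta> * \<tau>)) / \<tau>"
  shows "\<omega> + \<xi> * exp (\<omega> * \<tau>) \<le> \<eta>"
proof -
  have "lambertW (\<xi> * \<tau> * exp (\<eta> * \<tau>)) \<le> (\<eta> - \<omega>) * \<tau>"
    using assms(1,3) by (simp add: field_simps)
  from le_mult_exp_if_lambertW_le[OF _ this]
  have "\<tau> * (\<xi> * exp (\<eta> * \<tau>)) \<le> \<tau> * ((\<eta> - \<omega>) * exp ((\<eta> - \<omega>) * \<tau>))"
    using assms(1,2) by (simp add: mult_ac)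
  then have "\<xi> * exp (\<eta> * \<tau>) \<le> (\<eta> - \<omega>) * exp ((\<eta> - \<omega>) * \<tau>)"
    using assms(1) by simp
  then have "\<xi> * exp (\<eta> * \<tau>) * exp ((\<omega> - \<eta>) * \<tau>) \<le> (\<eta> - \<omega>) * exp ((\<eta> - \<omega>) * \<tau>) * exp ((\<omega> - \<eta>) * \<tau>)"
    by (rule mult_right_mono) simp
  then show ?thesis
    by (simp add: mult.assoc exp_add[symmetric] algebra_simps)
qed

text \<open>The same inversion for \<open>\<tau>tmin\<close>: growth of the error at rate at most D
  stays below the shrinking threshold up to \<tau>. The case D = 0 is split off because of the
  division by D.\<close>

lemma dwell_time_le:
  assumes "0 < \<omega>" "0 \<le> \<delta>" "0 \<le> D" "0 \<le> \<tau>" "\<tau> \<le> lambertW (\<omega> * \<delta> / D) / \<omega>"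
  shows "\<tau> * D \<le> \<delta> * exp (- \<omega> * \<tau>)"
proof (cases "D = 0")
  case True
  then show ?thesis using assms by simp
next
  case False
  then have "D > 0" using assms by simp
  have "\<omega> * \<tau> * exp (\<omega> * \<tau>) \<le> \<omega> * \<delta> / D"
    using assms by (intro mult_exp_le_if_le_lambertW) (auto simp: field_simps)
  then have "\<omega> * (\<tau> * D * exp (\<omega> * \<tau>)) \<le> \<omega> * \<delta>"
    using \<open>D > 0\<close> by (simp add: field_simps)
  then have "\<tau> * D * exp (\<omega> * \<tau>) \<le> \<delta>" using assms(1) by simp
  then show ?thesis by (simp add: exp_minus field_simps)
qed

section \<open>Increments of the states and absence of Zeno behaviour\<close>

lemma has_integral_increment:
  fixes u x :: "real \<Rightarrow> real"
  assumes "\<And>t. 0 \<le> t \<Longrightarrow> (u has_integral (x t - c)) {0..t}" "0 \<le> a" "a \<le> b"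
  shows "(u has_integral (x b - x a)) {a..b}"
proof -
  have ib: "u integrable_on {0..b}" using assms by (meson has_integral_integrable order_trans)
  then have iab: "u integrable_on {a..b}"
    using assms(2,3) by (rule_tac integrable_subinterval_real) auto
  have "integral {0..a} u + integral {a..b} u = integral {0..b} u"
    using Henstock_Kurzweil_Integration.integral_combine[OF assms(2,3) ib] .
  moreover have "integral {0..a} u = x a - c" "integral {0..b} u = x b - c"
    using assms by (auto intro!: integral_unique)
  ultimately have "integral {a..b} u = x b - x a" by simp
  with iab show ?thesis by (metis integrable_integral)
qed

lemma times_ge:
  fixes t :: "nat \<Rightarrow> real"
  assumes "t 0 = 0" "\<And>k. t k + h \<le> t (Suc k)"
  shows "real k * h \<le> t k"
proof (induction k)
  case (Suc k)
  then show ?case using assms(2)[of k] by (simp add: algebra_simps)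
qed (use assms in simp)

text \<open>A positive minimum dwell time h excludes accumulation of sampling times: t k \<le> T
  forces k \<le> T/h.\<close>

lemma finite_times_le:
  fixes t :: "nat \<Rightarrow> real"
  assumes "t 0 = 0" "0 < h" "\<And>k. t k + h \<le> t (Suc k)"
  shows "finite {k. t k \<le> T}"
proof (rule finite_subset)
  show "{k. t k \<le> T} \<subseteq> {..nat \<lceil>T / h\<rceil>}"
  proof
    fix k assume "k \<in> {k. t k \<le> T}"
    then have "real k * h \<le> T"
      using order_trans[OF times_ge[of t h k, OF assms(1,3)]] by simp
    then have "real k \<le> T / h" using assms(2) by (simp add: field_simps)
    then have "real k \<le> real_of_int \<lceil>T / h\<rceil>" by linarith
    then show "k \<in> {..nat \<lceil>T / h\<rceil>}" by auto
  qed
qed simp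

lemma sampling_interval_exists:
  fixes t :: "nat \<Rightarrow> real"
  assumes "t 0 = 0" "0 < h" "\<And>k. t k + h \<le> t (Suc k)" "0 \<le> s"
  obtains k where "t k \<le> s" "s < t (Suc k)"
proof -
  have fin: "finite {k. t k \<le> s}" by (rule finite_times_le[OF assms(1-3)])
  have ne: "{k. t k \<le> s} \<noteq> {}" using assms(1,4) by (metis empty_iff mem_Collect_eq)
  let ?k = "Max {k. t k \<le> s}"
  have "t ?k \<le> s" using Max_in[OF fin ne] by simp
  moreover have "\<not> t (Suc ?k) \<le> s" using Max_ge[OF fin, of "Suc ?k"] by auto
  ultimately show ?thesis using that by (meson not_le)
qed

section \<open>Consensus\<close>

theorem theorem1:
  fixes adj :: "'n::finite \<Rightarrow> 'n \<Rightarrow> bool"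
    and x :: "'n \<Rightarrow> real \<Rightarrow> real"      (* states x_i(t) *)
    and u :: "'n \<Rightarrow> real \<Rightarrow> real"      (* inputs u_i(t) *)
    and ts :: "'n \<Rightarrow> nat \<Rightarrow> real"     (* sampling times t^i_k *)
    and x0 :: "'n \<Rightarrow> real"
    and \<delta> \<tau>min \<tau>max :: "'n \<Rightarrow> real"
    and E0 \<gamma> \<omega> :: real and R0 :: nat
    and L :: "real^'n^'n" and \<Gamma> R :: real and E :: "real \<Rightarrow> real"
    and d \<tau>tmin \<xi> \<eta> :: "'n \<Rightarrow> real" and \<omega>t :: real
    and q :: "'n \<Rightarrow> nat \<Rightarrow> real" and f :: "'n \<Rightarrow> nat \<Rightarrow> real \<Rightarrow> real"
  assumes L_def: "L = laplacian adj"
    and Gamma_def: "\<Gamma> = Gamma_inf \<gamma> L"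
    and R_def: "R = real (2 * R0 + 1)"
    and E_def: "E = (\<lambda>t. 2 * \<Gamma> * E0 * exp (- \<omega> * t))"
    and d_def: "d = (\<lambda>i. real (degree adj i))"
    and q_def: "q = (\<lambda>i k. \<Sum>j \<in> nbrs adj i. quant (E (ts i k)) R0 (x i (ts i k) - x j (ts i k)))"
    and f_def: "f = (\<lambda>i k \<tau>. \<Sum>j \<in> nbrs adj i. integral {ts i k..ts i k + \<tau>} (\<lambda>s. u i s - u j s))"
    and tautmin_def: "\<tau>tmin = (\<lambda>i. lambertW (\<omega> * \<delta> i / ((d i)\<^sup>2 + (\<Sum>j \<in> nbrs adj i. d j * exp (\<omega> * \<tau>max j)))) / \<omega>)"
    and xi_def: "\<xi> = (\<lambda>i. 2 * \<Gamma> * d i / R)"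
    and eta_def: "\<eta> = (\<lambda>i. \<gamma> - 2 * \<Gamma> * \<delta> i)"
    and omegat_def: "\<omega>t = Min (range (\<lambda>i. \<eta> i - lambertW (\<xi> i * \<tau>max i * exp (\<eta> i * \<tau>max i)) / \<tau>max i))"
    and N2: "CARD('n) \<ge> 2"
    and graph: "undirected_graph adj" and conn: "connected_graph adj"
    and E0_pos: "E0 > 0"
    and E0_bound: "\<forall>i. \<bar>x0 i - (\<Sum>j\<in>UNIV. x0 j) / real CARD('n)\<bar> \<le> E0"
    and gamma: "0 < \<gamma>" "\<gamma> \<le> lambda2 L"
    and delta_pos: "\<forall>i. \<delta> i > 0"
    and tau_pos: "\<forall>i. 0 < \<tau>min i \<and> \<tau>min i \<le> \<tau>max i"
    and init: "\<forall>i. x i 0 = x0 i"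
    and ode: "\<forall>i. \<forall>t\<ge>0. (u i has_integral (x i t - x0 i)) {0..t}"
    and ctrl: "\<forall>i k s. ts i k \<le> s \<and> s < ts i (Suc k) \<longrightarrow> u i s = - q i k"
    and ts0: "\<forall>i. ts i 0 = 0"
    and ts_step: "\<forall>i k. ts i (Suc k) = ts i k +
        (let S = {\<tau>. \<tau> \<ge> \<tau>min i \<and> \<bar>f i k \<tau>\<bar> \<ge> \<delta> i * E (ts i k + \<tau>)}
         in if S = {} then \<tau>max i else min (Inf S) (\<tau>max i))"
    and a: "\<forall>i. \<delta> i + d i / R < \<gamma> / (2 * \<Gamma>)"
    and b: "\<forall>i. 0 < \<tau>min i \<and> \<tau>min i \<le> min (\<tau>tmin i) (\<tau>max i)"
    and c: "0 < \<omega>" "\<omega> \<le> \<omega>t"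
  shows "(\<forall>i k. \<forall>j \<in> nbrs adj i. \<bar>x i (ts i k) - x j (ts i k)\<bar> \<le> E (ts i k))
       \<and> (\<forall>t\<ge>0. \<forall>i j. \<bar>x i t - x j t\<bar> \<le> 2 * \<Gamma> * E0 * exp (- \<omega> * t))"
proof -

  \<comment> \<open>Constants and the decay-rate condition\<close>
  have \<Gamma>1: "1 \<le> \<Gamma>"
    using Gamma_inf_laplacian(2)[OF graph conn N2 gamma(2)[unfolded L_def]] by (simp add: Gamma_def L_def)
  have R: "R > 0" by (simp add: R_def)
  have E_pos: "E t > 0" for t using \<Gamma>1 E0_pos by (simp add: E_def)
  have E_shift: "E s = E r * exp (- \<omega> * (s - r))" for s r
    by (simp add: E_def mult.assoc exp_add[symmetric] algebra_simps)
  have d_nonneg: "d i \<ge> 0" for i by (simp add: d_def)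
  have card_nbrs: "real (card (nbrs adj i)) = d i" for i by (simp add: d_def degree_def)
  have \<tau>: "0 < \<tau>min i" "\<tau>min i \<le> \<tau>max i" "0 < \<tau>max i" "\<tau>min i \<le> \<tau>tmin i" for i
    using b[rule_format, of i] by auto
  have rate: "2 * \<Gamma> * (\<delta> i + d i / R * exp (\<omega> * \<tau>max i)) \<le> \<gamma> - \<omega>" for i
  proof -
    have "\<omega>t \<le> \<eta> i - lambertW (\<xi> i * \<tau>max i * exp (\<eta> i * \<tau>max i)) / \<tau>max i"
      unfolding omegat_def by (rule Min_le) auto
    then have "\<omega> + \<xi> i * exp (\<omega> * \<tau>max i) \<le> \<eta> i"
      using c(2) \<tau>(3)[of i] \<Gamma>1 R d_nonneg[of i] by (intro decay_rate_le) (auto simp: xi_def)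
    then show ?thesis by (simp add: xi_def eta_def algebra_simps)
  qed

  \<comment> \<open>Consequences of the triggering rule\<close>
  define S where "S i k = {\<tau>. \<tau> \<ge> \<tau>min i \<and> \<bar>f i k \<tau>\<bar> \<ge> \<delta> i * E (ts i k + \<tau>)}" for i k
  have S_ge: "\<tau>min i \<le> Inf (S i k)" if "S i k \<noteq> {}" for i k
    using that by (intro cInf_greatest) (auto simp: S_def)
  have ts_Suc: "ts i (Suc k) = ts i k + (if S i k = {} then \<tau>max i else min (Inf (S i k)) (\<tau>max i))" for i k
    using ts_step unfolding S_def Let_def by blast
  have step_ge: "ts i k + \<tau>min i \<le> ts i (Suc k)" for i k
    unfolding ts_Suc using S_ge[of i k] \<tau>(2)[of i] by simp
  have step_le: "ts i (Suc k) \<le> ts i k + \<tau>max i" for i k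
    unfolding ts_Suc by simp
  have trigger: "\<bar>f i k \<tau>\<bar> \<le> \<delta> i * E (ts i k + \<tau>)" if "\<tau>min i \<le> \<tau>" "ts i k + \<tau> < ts i (Suc k)" for i k \<tau>
  proof -
    \<comment> \<open>A member of S would bound its infimum from above, and the next sampling would
      already have occurred by then.\<close>
    have "\<tau> \<notin> S i k"
    proof
      assume "\<tau> \<in> S i k"
      then have "Inf (S i k) \<le> \<tau>"
        by (intro cInf_lower bdd_belowI[of _ "\<tau>min i"]) (auto simp: S_def)
      moreover have "S i k \<noteq> {}" using \<open>\<tau> \<in> S i k\<close> by blast
      ultimately show False using that(2) unfolding ts_Suc by simp
    qed
    then show ?thesis using that(1) by (simp add: S_def)
  qed
  have ts_nonneg: "0 \<le> ts i k" for i k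
    using times_ge[of "ts i" "\<tau>min i" k] ts0 step_ge \<tau>(1)[of i] by (smt (verit) of_nat_0_le_iff mult_nonneg_nonneg)
  have fin: "finite {k. ts i k \<le> T}" for i T
    using finite_times_le[of "ts i" "\<tau>min i"] ts0 step_ge \<tau>(1) by blast
  have cover: "\<exists>k. ts i k \<le> s \<and> s < ts i (Suc k)" if "0 \<le> s" for i s
    using sampling_interval_exists[of "ts i" "\<tau>min i" s] ts0 step_ge \<tau>(1) that by metis
  have incr: "(u i has_integral (x i t - x i s)) {s..t}" if "0 \<le> s" "s \<le> t" for i s t
    using has_integral_increment[of "u i" "x i" "x0 i"] ode that by blast
  \<comment> \<open>The trigger function is the change of the summed relative positions since the
    last sample of agent i.\<close>
  have f_eq: "f i k \<tau> = (\<Sum>j\<in>nbrs adj i. (x i (ts i k + \<tau>) - x i (ts i k)) - (x j (ts i k + \<tau>) - x j (ts i k)))"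
    if "0 \<le> \<tau>" for i k \<tau>
    unfolding f_def using that ts_nonneg[of i k]
    by (intro sum.cong refl integral_unique has_integral_diff incr) auto
  have u_eq: "u i s = - q i k" if "ts i k \<le> s" "s < ts i (Suc k)" for i k s
    using ctrl that by blast

  \<comment> \<open>Disturbance estimate under unsaturated quantizers\<close>
  define unsat where "unsat i k \<longleftrightarrow> (\<forall>j\<in>nbrs adj i. \<bar>x i (ts i k) - x j (ts i k)\<bar> \<le> E (ts i k))" for i k
  have q_le: "\<bar>q i k\<bar> \<le> d i * E (ts i k)" if "unsat i k" for i k
  proof -
    have "\<bar>q i k\<bar> \<le> (\<Sum>j\<in>nbrs adj i. E (ts i k))"
      unfolding q_def using that E_pos
      by (intro order_trans[OF sum_abs] sum_mono abs_quant_le) (auto simp: unsat_def)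
    then show ?thesis by (simp add: card_nbrs)
  qed
  \<comment> \<open>Errors are scaled by E at the last sample; since that sample is at most
    \<tau>max old, passing to the current E costs this factor.\<close>
  have E_sample: "E (ts i k) \<le> exp (\<omega> * \<tau>max i) * E s" if "s < ts i (Suc k)" for i k s
  proof -
    have "s - ts i k \<le> \<tau>max i" using that step_le[of i k] by simp
    then have "exp (\<omega> * (s - ts i k)) * E s \<le> exp (\<omega> * \<tau>max i) * E s"
      using c(1) E_pos[of s] by (intro mult_right_mono) auto
    then show ?thesis unfolding E_shift[of "ts i k" s] by (simp add: algebra_simps)
  qed
  have disturbance: "\<bar>(\<Sum>j\<in>nbrs adj i. x i s - x j s) + u i s\<bar> \<le> (\<gamma> - \<omega>) * E0 * exp (- \<omega> * s)"
    if s: "0 \<le> s" and good: "\<And>i k. ts i k \<le> s \<Longrightarrow> unsat i k" for i s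
  proof -
    obtain k where k: "ts i k \<le> s" "s < ts i (Suc k)" using cover[OF s] by blast
    define \<tau> where "\<tau> = s - ts i k"
    have \<tau>0: "0 \<le> \<tau>" and s_eq: "s = ts i k + \<tau>" using k by (auto simp: \<tau>_def)
    \<comment> \<open>From \<tau>min on, this is enforced by the trigger; earlier it follows from
      the bounds on the inputs and the choice of \<tau>min.\<close>
    have f_le: "\<bar>f i k \<tau>\<bar> \<le> \<delta> i * E s"
    proof (cases "\<tau>min i \<le> \<tau>")
      case True
      then show ?thesis using trigger[of i \<tau> k] k by (simp add: s_eq)
    next
      case False
      have x_incr: "\<bar>x j s - x j (ts i k)\<bar> \<le> B * \<tau>"
        if "0 \<le> B" "\<And>r. ts i k \<le> r \<Longrightarrow> r \<le> s \<Longrightarrow> \<bar>u j r\<bar> \<le> B" for j B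
        using has_integral_bound_real[OF that(1) finite.emptyI incr[OF ts_nonneg k(1), of j]] that(2) \<tau>0
        by (auto simp: \<tau>_def)
      have "\<bar>u i r\<bar> \<le> d i * E (ts i k)" if "ts i k \<le> r" "r \<le> s" for r
        using that k q_le[OF good[OF k(1)]] by (subst u_eq[of i k]) auto
      then have own: "\<bar>x i s - x i (ts i k)\<bar> \<le> d i * E (ts i k) * \<tau>"
        using d_nonneg[of i] E_pos[of "ts i k"] by (intro x_incr) auto
      \<comment> \<open>Agent j samples on its own clock, so its current input may stem from a
        sample before \<open>ts i k\<close>, taken with a larger range; hence the factor
        exp(\<omega> \<tau>max j).\<close>
      have other: "\<bar>x j s - x j (ts i k)\<bar> \<le> d j * exp (\<omega> * \<tau>max j) * E (ts i k) * \<tau>" for j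
      proof (rule x_incr)
        show "0 \<le> d j * exp (\<omega> * \<tau>max j) * E (ts i k)"
          using d_nonneg[of j] E_pos[of "ts i k"] by simp
        fix r assume r: "ts i k \<le> r" "r \<le> s"
        obtain l where l: "ts j l \<le> r" "r < ts j (Suc l)"
          using cover[of r j] r ts_nonneg[of i k] by auto
        have "\<bar>u j r\<bar> \<le> d j * E (ts j l)"
          using q_le[OF good[of j l]] l r by (subst u_eq[OF l]) auto
        also have "\<dots> \<le> d j * (exp (\<omega> * \<tau>max j) * E r)"
          by (intro mult_left_mono E_sample l d_nonneg)
        also have "\<dots> \<le> d j * (exp (\<omega> * \<tau>max j) * E (ts i k))"
          using r(1) c(1) \<Gamma>1 E0_pos by (intro mult_left_mono d_nonneg) (auto simp: E_def)
        finally show "\<bar>u j r\<bar> \<le> d j * exp (\<omega> * \<tau>max j) * E (ts i k)"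
          by (simp add: mult.assoc)
      qed
      \<comment> \<open>The denominator in \<open>\<tau>tmin\<close>: the agent's own rate d i is
        counted once per neighbour, giving the square.\<close>
      define D where "D = (d i)\<^sup>2 + (\<Sum>j\<in>nbrs adj i. d j * exp (\<omega> * \<tau>max j))"
      have "\<bar>f i k \<tau>\<bar> \<le> (\<Sum>j\<in>nbrs adj i. d i * E (ts i k) * \<tau> + d j * exp (\<omega> * \<tau>max j) * E (ts i k) * \<tau>)"
        unfolding f_eq[OF \<tau>0] s_eq[symmetric]
        by (intro order_trans[OF sum_abs] sum_mono order_trans[OF abs_triangle_ineq4] add_mono own other)
      also have "\<dots> = \<tau> * D * E (ts i k)"
        by (simp add: D_def sum.distrib card_nbrs power2_eq_square sum_distrib_right sum_distrib_left algebra_simps)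
      also have "\<dots> \<le> \<delta> i * exp (- \<omega> * \<tau>) * E (ts i k)"
      proof (intro mult_right_mono dwell_time_le)
        show "\<tau> \<le> lambertW (\<omega> * \<delta> i / D) / \<omega>"
          using False \<tau>(4)[of i] by (simp add: tautmin_def D_def)
        show "0 \<le> D" unfolding D_def by (intro add_nonneg_nonneg sum_nonneg) (auto simp: d_nonneg)
        show "0 \<le> \<delta> i" using delta_pos by (simp add: less_imp_le)
        show "0 \<le> E (ts i k)" using E_pos by (simp add: less_imp_le)
      qed (fact c(1) \<tau>0)+
      also have "\<dots> = \<delta> i * E s"
        by (simp add: E_shift[of s "ts i k"] \<tau>_def mult_ac)
      finally show ?thesis .
    qed
    define z where "z j = x i (ts i k) - x j (ts i k)" for j
    \<comment> \<open>Current differences are sampled differences plus f, and the input subtracts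
      the quantized samples; only the quantization error is left beside f.\<close>
    have "(\<Sum>j\<in>nbrs adj i. x i s - x j s) + u i s
        = f i k \<tau> - (\<Sum>j\<in>nbrs adj i. quant (E (ts i k)) R0 (z j) - z j)"
      unfolding f_eq[OF \<tau>0] s_eq[symmetric] u_eq[OF k] q_def z_def
      by (simp add: sum_subtractf sum.distrib algebra_simps)
    moreover have "\<bar>\<Sum>j\<in>nbrs adj i. quant (E (ts i k)) R0 (z j) - z j\<bar> \<le> d i / R * (exp (\<omega> * \<tau>max i) * E s)"
    proof -
      have "\<bar>\<Sum>j\<in>nbrs adj i. quant (E (ts i k)) R0 (z j) - z j\<bar> \<le> (\<Sum>j\<in>nbrs adj i. E (ts i k) / R)"
        unfolding R_def using good[OF k(1)] E_pos
        by (intro order_trans[OF sum_abs] sum_mono quant_error) (auto simp: unsat_def z_def)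
      also have "\<dots> = d i / R * E (ts i k)" by (simp add: card_nbrs)
      also have "\<dots> \<le> d i / R * (exp (\<omega> * \<tau>max i) * E s)"
        using R d_nonneg[of i] by (intro mult_left_mono E_sample k) auto
      finally show ?thesis .
    qed
    ultimately have "\<bar>(\<Sum>j\<in>nbrs adj i. x i s - x j s) + u i s\<bar>
        \<le> \<delta> i * E s + d i / R * (exp (\<omega> * \<tau>max i) * E s)"
      using f_le by linarith
    also have "\<dots> = 2 * \<Gamma> * (\<delta> i + d i / R * exp (\<omega> * \<tau>max i)) * (E0 * exp (- \<omega> * s))"
      by (simp add: E_def algebra_simps)
    also have "\<dots> \<le> (\<gamma> - \<omega>) * (E0 * exp (- \<omega> * s))"
      using E0_pos by (intro mult_right_mono rate) auto
    finally show ?thesis by (simp add: mult.assoc)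
  qed

  \<comment> \<open>Consensus bound at T from unsaturation strictly before T\<close>
  have bound: "\<bar>x i T - x j T\<bar> \<le> E T"
    if T: "0 \<le> T" and good: "\<And>i k. ts i k < T \<Longrightarrow> unsat i k" for i j T
  proof -
    \<comment> \<open>All instants up to T at which some agent samples. Away from them every input
      is locally constant, so the states are differentiable.\<close>
    define J where "J = (\<Union>i. ts i ` {k. ts i k \<le> T})"
    have "finite J" unfolding J_def using fin by auto
    have cont: "continuous_on {0..T} (x i)" for i
    proof -
      have "continuous_on {0..T} (\<lambda>t. x0 i + integral {0..t} (u i))"
        using ode T by (intro continuous_intros indefinite_integral_continuous_1) blast
      moreover have "x0 i + integral {0..t} (u i) = x i t" if "t \<in> {0..T}" for t
        using integral_unique[OF ode[rule_format, of t i]] that by simp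
      ultimately show ?thesis by (rule continuous_on_eq)
    qed
    have deriv: "(x i has_real_derivative u i s) (at s)" if sJ: "s \<in> {0<..<T} - J" for i s
    proof -
      obtain k where k: "ts i k \<le> s" "s < ts i (Suc k)" using cover[of s i] sJ by auto
      have "ts i k \<noteq> s" using sJ by (force simp: J_def)
      have affine: "x i (ts i k) + (r - ts i k) * - q i k = x i r" if "r \<in> {ts i k<..<ts i (Suc k)}" for r
      proof -
        have "((\<lambda>_. - q i k) has_integral (x i r - x i (ts i k))) {ts i k..r}"
          using incr[OF ts_nonneg, of i k r i] that by (subst has_integral_cong[of _ _ "u i"]) (auto simp: u_eq)
        from has_integral_unique[OF this has_integral_const_real] that show ?thesis by (simp add: algebra_simps)
      qed
      have "((\<lambda>r. x i (ts i k) + (r - ts i k) * - q i k) has_real_derivative - q i k) (at s)"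
        by (auto intro!: derivative_eq_intros)
      then have "(x i has_real_derivative - q i k) (at s)"
        by (rule has_field_derivative_transform_within_open[OF _ open_greaterThanLessThan _ affine])
          (use k \<open>ts i k \<noteq> s\<close> in auto)
      then show ?thesis using u_eq[OF k] by simp
    qed
    have "\<bar>x i T - (\<Sum>j\<in>UNIV. x j T) / real CARD('n)\<bar> \<le> \<Gamma> * E0 * exp (- \<omega> * T)" for i
    proof (rule consensus_error_bound[OF graph conn N2 gamma(2)[unfolded L_def] Gamma_def[unfolded L_def]
          _ T \<open>finite J\<close> cont deriv])
      show "\<bar>x i 0 - (\<Sum>j\<in>UNIV. x j 0) / real CARD('n)\<bar> \<le> E0" for i
        using E0_bound init by simp
      show "\<bar>(\<Sum>j\<in>nbrs adj i. x i s - x j s) + u i s\<bar> \<le> (\<gamma> - \<omega>) * E0 * exp (- \<omega> * s)"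
        if "s \<in> {0<..<T} - J" for i s
        using that by (intro disturbance good) auto
    qed
    \<comment> \<open>Each agent is within half of E T of the average, which accounts for the factor
      2 in E.\<close>
    from this[of i] this[of j] show ?thesis unfolding E_def by linarith
  qed

  \<comment> \<open>Exclusion of a first saturated sample\<close>
  have all_unsat: "unsat i k" for i k
  proof (rule ccontr)
    assume "\<not> unsat i k"
    \<comment> \<open>The saturated samples of all agents up to \<open>ts i k\<close>; there are
      finitely many, so one is earliest. All strictly earlier samples are unsaturated, and
      \<open>bound\<close> at that instant contradicts its saturation, even if several agents sample
      simultaneously.\<close>
    define P where "P = {p. \<not> unsat (fst p) (snd p) \<and> ts (fst p) (snd p) \<le> ts i k}"
    have "P \<subseteq> (SIGMA j:UNIV. {l. ts j l \<le> ts i k})" by (auto simp: P_def)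
    then have "finite P" by (rule finite_subset) (intro finite_SigmaI fin finite)
    moreover have "P \<noteq> {}" using \<open>\<not> unsat i k\<close> by (auto simp: P_def)
    ultimately obtain p where p: "p \<in> P" "\<And>p'. p' \<in> P \<Longrightarrow> ts (fst p) (snd p) \<le> ts (fst p') (snd p')"
      using ex_min_if_finite[of "(\<lambda>p. ts (fst p) (snd p)) ` P"] by (auto simp: not_less)
    have "unsat j l" if "ts j l < ts (fst p) (snd p)" for j l
      using p(2)[of "(j, l)"] p(1) that by (force simp: P_def)
    then have "unsat (fst p) (snd p)"
      unfolding unsat_def[of "fst p"] using bound[OF ts_nonneg] by blast
    then show False using p(1) by (simp add: P_def)
  qed
  show ?thesis
  proof (intro conjI allI impI ballI)
    show "\<bar>x i (ts i k) - x j (ts i k)\<bar> \<le> E (ts i k)" if "j \<in> nbrs adj i" for i k j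
      using all_unsat[of i k] that by (simp add: unsat_def)
    show "\<bar>x i t - x j t\<bar> \<le> 2 * \<Gamma> * E0 * exp (- \<omega> * t)" if "0 \<le> t" for t i j
      using bound[OF that all_unsat, of i j] by (simp add: E_def)
  qed
qed

end
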